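(* Let $\Omega\subset\mathbb{R}^n$ be a convex subset with the additional property that, for every convex combination $x=\lambda_1x_1+\cdots+\lambda_kx_k$ ($\lambda_i\ge 0$, $\lambda_1+\cdots+\lambda_k=1$) with all $x_i\in\Omega$, $x\in\Omega$ and $x_i\ne x$ for all $i$, we have $x\in\Omega^{\mathrm{ri}}$. Let $A\subset\mathbb{R}^n$ be a closed subset of dimension $\le\dim\Omega-2$. Then for functions $f:\Omega-A\to\mathbb{R}$, convexity, local convexity and interval convexity on $\Omega-A$ are equivalent. Moreover, strict convexity, strict local convexity and strict interval convexity on $\Omega-A$ are also equivalent.
   Context: All functions are real valued. $\Omega^{\mathrm{ri}}$ is the relative interior of $\Omega$ (interior relative to its affine hull). For a function $f$ on a (not necessarily convex) set $S\subset\mathbb{R}^n$: (1) $f$ is convex if $f(x)\le \lambda_1 f(x_1)+\cdots+\lambda_k f(x_k)$ whenever $x_1,\dots,x_k\in S$, $\lambda_i\ge 0$, $\lambda_1+\cdots+\lambda_k=1$, and $x=\lambda_1x_1+\cdots+\lambda_kx_k$ also lies in $S$; (2) $f$ is locally convex if for every $x\in S$ there is a ball $B$ around $x$ such that the restriction of $f$ to $B\cap S$ is convex in the sense of (1); (3) $f$ is interval convex if the restriction of $f$ to any interval (straight line segment) contained in $S$ is convex. The strict versions are obtained by requiring the inequality in (1) to be strict whenever all $x_i\neq x$. $\dim\Omega$ is the dimension of the affine hull of $\Omega$. The dimension of $A$ may be defined in various ways, depending on whether $A$ is a union of finitely many submanifolds, a polyhedron, or some other topologically nice subset; the meaning of the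 dimension condition is only its "general position" consequence: if $x,y$ (in $\Omega$) are outside $A$, then $y$ can be moved by an arbitrarily small distance (within $\Omega$) so that the straight line connecting $x$ and $y$ avoids $A$. *)

theory Defs
  imports "HOL-Analysis.Analysis"
begin

text \<open>
  Convexity on a set that need not be convex. The library's \<open>convex_on\<close> is not applicable, since it
  demands that the domain be convex and compares only two points at a time; on a non-convex domain
  the condition for two points does not yield the one for \<open>k\<close> points.
\<close>

definition convex_fun_on :: "'a::real_vector set \<Rightarrow> ('a \<Rightarrow> real) \<Rightarrow> bool" where
  "convex_fun_on S f \<longleftrightarrow>
    (\<forall>(k::nat) (l::nat \<Rightarrow> real) (y::nat \<Rightarrow> 'a) x.
      (\<forall>i\<in>{1..k}. 0 \<le> l i \<and> y i \<in> S) \<and> (\<Sum>i=1..k. l i) = 1 \<and>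
      x = (\<Sum>i=1..k. l i *\<^sub>R y i) \<and> x \<in> S
      \<longrightarrow> f x \<le> (\<Sum>i=1..k. l i * f (y i)))"

definition strict_convex_fun_on :: "'a::real_vector set \<Rightarrow> ('a \<Rightarrow> real) \<Rightarrow> bool" where
  "strict_convex_fun_on S f \<longleftrightarrow>
    convex_fun_on S f \<and>
    (\<forall>(k::nat) (l::nat \<Rightarrow> real) (y::nat \<Rightarrow> 'a) x.
      (\<forall>i\<in>{1..k}. 0 \<le> l i \<and> y i \<in> S) \<and> (\<Sum>i=1..k. l i) = 1 \<and>
      x = (\<Sum>i=1..k. l i *\<^sub>R y i) \<and> x \<in> S \<and> (\<forall>i\<in>{1..k}. y i \<noteq> x)
      \<longrightarrow> f x < (\<Sum>i=1..k. l i * f (y i)))"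

definition locally_convex_fun_on :: "'a::real_normed_vector set \<Rightarrow> ('a \<Rightarrow> real) \<Rightarrow> bool" where
  "locally_convex_fun_on S f \<longleftrightarrow> (\<forall>x\<in>S. \<exists>r>0. convex_fun_on (ball x r \<inter> S) f)"

definition strict_locally_convex_fun_on :: "'a::real_normed_vector set \<Rightarrow> ('a \<Rightarrow> real) \<Rightarrow> bool" where
  "strict_locally_convex_fun_on S f \<longleftrightarrow> (\<forall>x\<in>S. \<exists>r>0. strict_convex_fun_on (ball x r \<inter> S) f)"

definition interval_convex_fun_on :: "'a::real_vector set \<Rightarrow> ('a \<Rightarrow> real) \<Rightarrow> bool" where
  "interval_convex_fun_on S f \<longleftrightarrow>
    (\<forall>a b. closed_segment a b \<subseteq> S \<longrightarrow> convex_fun_on (closed_segment a b) f)"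

definition strict_interval_convex_fun_on :: "'a::real_vector set \<Rightarrow> ('a \<Rightarrow> real) \<Rightarrow> bool" where
  "strict_interval_convex_fun_on S f \<longleftrightarrow>
    (\<forall>a b. closed_segment a b \<subseteq> S \<longrightarrow> strict_convex_fun_on (closed_segment a b) f)"

text \<open>
  Points of \<open>\<Omega>\<close> that are convex combinations of points of \<open>\<Omega>\<close> different from them lie in the relative
  interior. For convex \<open>\<Omega>\<close> the combination is automatically in \<open>\<Omega>\<close>.
\<close>

definition proper_combinations_in_rel_interior :: "'a::euclidean_space set \<Rightarrow> bool" where
  "proper_combinations_in_rel_interior \<Omega> \<longleftrightarrow>
    (\<forall>(k::nat) (l::nat \<Rightarrow> real) (y::nat \<Rightarrow> 'a) x.
      (\<forall>i\<in>{1..k}. 0 \<le> l i \<and> y i \<in> \<Omega>) \<and> (\<Sum>i=1..k. l i) = 1 \<and>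
      x = (\<Sum>i=1..k. l i *\<^sub>R y i) \<and> x \<in> \<Omega> \<and> (\<forall>i\<in>{1..k}. y i \<noteq> x)
      \<longrightarrow> x \<in> rel_interior \<Omega>)"

text \<open>
  The meaning of ``\<open>A\<close> has dimension at most \<open>dim \<Omega> - 2\<close>''. No particular dimension theory for \<open>A\<close>
  (finite unions of submanifolds, polyhedra, \<open>\<dots>\<close>) is fixed; the condition stands for its general
  position consequence: of two points of \<open>\<Omega> - A\<close>, the second can be moved within \<open>\<Omega>\<close> by an
  arbitrarily small distance so that the segment joining them misses \<open>A\<close>.
\<close>

definition general_position_codim_two :: "'a::euclidean_space set \<Rightarrow> 'a set \<Rightarrow> bool" where
  "general_position_codim_two \<Omega> A \<longleftrightarrow>
    (\<forall>x\<in>\<Omega> - A. \<forall>y\<in>\<Omega> - A. \<forall>e>0. \<exists>y'\<in>\<Omega>. dist y' y < e \<and> closed_segment x y' \<inter> A = {})"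

end

theory Submission
  imports Defs
begin

text \<open>
  Interval convexity implies convexity by perturbing the base point. Let \<open>x = \<Sum> l\<^sub>i y\<^sub>i\<close> with all
  \<open>y\<^sub>i \<noteq> x\<close>, so that \<open>x\<close> lies in the relative interior and \<open>f\<close> is convex, hence continuous, near \<open>x\<close>.
  General position gives points \<open>x'\<close> arbitrarily close to \<open>x\<close> all of whose segments to the \<open>y\<^sub>i\<close> miss
  \<open>A\<close>. For a small fixed \<open>t > 0\<close> the points \<open>x' + t (y\<^sub>i - x')\<close> stay near \<open>x\<close>, so convexity near \<open>x\<close>
  and along the segments yields \<open>f (x' + t (x - x')) \<le> (1 - t) f x' + t \<Sum> l\<^sub>i f (y\<^sub>i)\<close>, and
  \<open>x' \<longrightarrow> x\<close> gives the claim. Local convexity implies interval convexity by gluing convex pieces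
  along a segment, and strictness near \<open>x\<close> propagates by the same contraction towards \<open>x\<close>.
\<close>

subsection \<open>Convexity on the real line is local\<close>

text \<open>The slope over the whole interval is the mean of the two adjacent slopes, weighted by
  the lengths \<open>v - u\<close> and \<open>w - v\<close>, so it lies between them.\<close>

lemma slope_mediant:
  fixes f :: "real \<Rightarrow> real"
  assumes "u < v" "v < w" "(f v - f u) / (v - u) \<le> (f w - f v) / (w - v)"
  shows "(f v - f u) / (v - u) \<le> (f w - f u) / (w - u)"
    and "(f w - f u) / (w - u) \<le> (f w - f v) / (w - v)"
proof -
  define p q where "p = (f v - f u) / (v - u)" and "q = (f w - f v) / (w - v)"
  have fv: "f v - f u = p * (v - u)" and fw: "f w - f v = q * (w - v)"
    using assms by (simp_all add: p_def q_def)
  have eq: "f w - f u = p * (v - u) + q * (w - v)"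
    using fv fw by linarith
  have "p \<le> q" using assms(3) by (simp add: p_def q_def)
  then have "p * (w - v) \<le> q * (w - v)" "p * (v - u) \<le> q * (v - u)"
    using assms by (auto intro: mult_right_mono)
  then have "p * (w - u) \<le> f w - f u" "f w - f u \<le> q * (w - u)"
    unfolding eq by (simp_all add: algebra_simps)
  then show "(f v - f u) / (v - u) \<le> (f w - f u) / (w - u)"
    and "(f w - f u) / (w - u) \<le> (f w - f v) / (w - v)"
    unfolding p_def[symmetric] q_def[symmetric] using assms
    by (simp_all add: pos_le_divide_eq pos_divide_le_eq)
qed

text \<open>A form of \<open>convex_on_slope_le\<close> in which all denominators are positive, so
  that the estimates can be chained.\<close>

lemma convex_on_slopes:
  fixes f :: "real \<Rightarrow> real"
  assumes "convex_on I f" "u \<in> I" "w \<in> I" "u < v" "v < w"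
  shows "(f v - f u) / (v - u) \<le> (f w - f u) / (w - u)"
    and "(f w - f u) / (w - u) \<le> (f w - f v) / (w - v)"
proof -
  have flip: "(f p - f q) / (p - q) = (f q - f p) / (q - p)" for p q
    using minus_divide_divide[of "f q - f p" "q - p"] by simp
  show "(f v - f u) / (v - u) \<le> (f w - f u) / (w - u)"
    and "(f w - f u) / (w - u) \<le> (f w - f v) / (w - v)"
    using convex_on_slope_le[OF assms] unfolding flip[of u] flip[of v w] by simp_all
qed

text \<open>For \<open>v = (1 - t) * x + t * y\<close> the adjacent intervals have lengths
  \<open>t * (y - x)\<close> and \<open>(1 - t) * (y - x)\<close>. Clearing denominators and
  cancelling \<open>y - x\<close> turns the slope comparison into the convexity inequality.\<close>

lemma convex_on_slopesI:
  fixes f :: "real \<Rightarrow> real"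
  assumes "\<And>u v w. \<lbrakk>u \<in> I; w \<in> I; u < v; v < w\<rbrakk> \<Longrightarrow> (f v - f u) / (v - u) \<le> (f w - f v) / (w - v)"
    and "convex I"
  shows "convex_on I f"
proof (rule convex_on_linorderI)
  fix t x y :: real
  assume t: "0 < t" "t < 1" and xy: "x \<in> I" "y \<in> I" "x < y"
  define v where "v = (1 - t) * x + t * y"
  have vx: "v - x = t * (y - x)" and yv: "y - v = (1 - t) * (y - x)"
    by (simp_all add: v_def algebra_simps)
  have "0 < v - x" "0 < y - v"
    unfolding vx yv using t xy(3) by simp_all
  then have v: "x < v" "v < y" by simp_all
  have cross: "p * s \<le> q * r" if "p / r \<le> q / s" "0 < r" "0 < s" for p q r s :: real
    using that by (simp add: field_simps)
  have "(f v - f x) * (y - v) \<le> (f y - f v) * (v - x)"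
    using cross[OF assms(1)[OF xy(1,2) v]] v by simp
  then have "((f v - f x) * (1 - t)) * (y - x) \<le> ((f y - f v) * t) * (y - x)"
    unfolding vx yv by (simp add: mult.assoc)
  then have "(f v - f x) * (1 - t) \<le> (f y - f v) * t"
    using xy(3) by simp
  then show "f ((1 - t) *\<^sub>R x + t *\<^sub>R y) \<le> (1 - t) * f x + t * f y"
    by (simp add: v_def algebra_simps)
qed fact

text \<open>The essential case is a triple with middle point \<open>b\<close>. Moving its outer
  points towards \<open>b\<close> raises the left slope and lowers the right one, so it suffices to
  compare slopes near \<open>b\<close>, where \<open>M\<close> applies.\<close>

lemma convex_on_glue:
  fixes f :: "real \<Rightarrow> real"
  assumes L: "convex_on {a..b} f" and R: "convex_on {b..c} f"
    and d: "d > 0" and M: "convex_on ({b-d<..<b+d} \<inter> {a..c}) f" and "a < b" "b < c"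
  shows "convex_on {a..c} f"
proof (rule convex_on_slopesI)
  have mid: "(f b - f u) / (b - u) \<le> (f w - f b) / (w - b)"
    if "a \<le> u" "u < b" "b < w" "w \<le> c" for u w
  proof -
    \<comment> \<open>The midpoints keep \<open>u'\<close> and \<open>w'\<close> strictly between
      the outer points and \<open>b\<close>; the offsets \<open>d / 2\<close> put them into the
      domain of \<open>M\<close>.\<close>
    define u' w' where "u' = max ((u + b) / 2) (b - d / 2)" and "w' = min ((w + b) / 2) (b + d / 2)"
    have u': "u < u'" "u' < b" "b - d < u'" and w': "b < w'" "w' < w" "w' < b + d"
      using that d by (auto simp: u'_def w'_def field_simps less_max_iff_disj min_less_iff_disj)
    have "(f b - f u) / (b - u) \<le> (f b - f u') / (b - u')"
      by (rule convex_on_slopes(2)[OF L]) (use that u' in auto)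
    also have "\<dots> \<le> (f w' - f u') / (w' - u')"
      by (rule convex_on_slopes(1)[OF M]) (use that u' w' in auto)
    also have "\<dots> \<le> (f w' - f b) / (w' - b)"
      by (rule convex_on_slopes(2)[OF M]) (use that u' w' in auto)
    also have "\<dots> \<le> (f w - f b) / (w - b)"
      by (rule convex_on_slopes(1)[OF R]) (use that w' in auto)
    finally show ?thesis .
  qed
  fix u v w assume uw: "u \<in> {a..c}" "w \<in> {a..c}" "u < v" "v < w"
  \<comment> \<open>In the last two cases \<open>b\<close> is interior to one of the two adjacent
    intervals. Its slope is compared by \<open>slope_mediant\<close> with that of the part on the
    side of \<open>v\<close>, which leaves a comparison within one half.\<close>
  consider "w \<le> b" | "b \<le> u" | "v = b" | "v < b" "b < w" | "u < b" "b < v"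
    by linarith
  then show "(f v - f u) / (v - u) \<le> (f w - f v) / (w - v)"
  proof cases
    case 1
    then show ?thesis
      using convex_on_slopes[OF L, of u w v] uw by force
  next
    case 2
    then show ?thesis
      using convex_on_slopes[OF R, of u w v] uw by force
  next
    case 3
    then show ?thesis using mid uw by auto
  next
    case 4
    have "(f v - f u) / (v - u) \<le> (f b - f v) / (b - v)"
      using convex_on_slopes[OF L, of u b v] uw 4 by force
    also have "\<dots> \<le> (f w - f v) / (w - v)"
      by (rule slope_mediant(1)[OF 4 mid]) (use 4 uw in auto)
    finally show ?thesis .
  next
    case 5
    have "(f v - f u) / (v - u) \<le> (f v - f b) / (v - b)"
      by (rule slope_mediant(2)[OF 5 mid]) (use 5 uw in auto)
    also have "\<dots> \<le> (f w - f v) / (w - v)"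
      using convex_on_slopes[OF R, of b w v] uw 5 by force
    finally show ?thesis .
  qed
qed simp

text \<open>Bolzano's bisection principle: the claim holds on short intervals and passes to the
  union of two adjacent ones by \<open>convex_on_glue\<close>.\<close>

lemma convex_on_Icc_local:
  fixes f :: "real \<Rightarrow> real"
  assumes "a \<le> b"
    and loc: "\<And>x. x \<in> {a..b} \<Longrightarrow> \<exists>d>0. convex_on ({x-d<..<x+d} \<inter> {a..b}) f"
  shows "convex_on {a..b} f"
proof -
  \<comment> \<open>The inclusion is made part of the property because the short intervals in the
    local case may stick out of \<open>{a..b}\<close>.\<close>
  have "{a..b} \<subseteq> {a..b} \<longrightarrow> convex_on {a..b} f"
    using \<open>a \<le> b\<close>
  proof (induction rule: Bolzano[where P = "\<lambda>s t. {s..t} \<subseteq> {a..b} \<longrightarrow> convex_on {s..t} f"])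
    case (trans s t u)
    show ?case
    proof (cases "s < t \<and> t < u")
      case True
      show ?thesis
      proof
        assume sub: "{s..u} \<subseteq> {a..b}"
        then have "t \<in> {a..b}" using True by auto
        then obtain d where d: "d > 0" "convex_on ({t-d<..<t+d} \<inter> {a..b}) f"
          using loc by blast
        have "convex_on ({t-d<..<t+d} \<inter> {s..u}) f"
        proof (rule convex_on_subset[OF d(2)])
          show "{t-d<..<t+d} \<inter> {s..u} \<subseteq> {t-d<..<t+d} \<inter> {a..b}" using sub by blast
          show "convex ({t-d<..<t+d} \<inter> {s..u})" by (intro convex_Int) simp_all
        qed
        moreover have "{s..t} \<subseteq> {a..b}" "{t..u} \<subseteq> {a..b}"
          using True sub by auto
        ultimately show "convex_on {s..u} f"
          using trans.IH True d(1) by (intro convex_on_glue[of s t f u d]) simp_all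
      qed
    next
      case False
      then have "s = t \<or> t = u" using trans by auto
      then show ?thesis using trans.IH by blast
    qed
  next
    case (local x)
    then obtain d where d: "d > 0" "convex_on ({x-d<..<x+d} \<inter> {a..b}) f"
      using loc[of x] by auto
    have "convex_on {s..t} f" if "s \<le> x \<and> x \<le> t \<and> t - s < d" "{s..t} \<subseteq> {a..b}" for s t
      using d(2) by (rule convex_on_subset) (use that in auto)
    then show ?case using d(1) by blast
  qed
  then show ?thesis by simp
qed

subsection \<open>Convexity of functions on general sets\<close>

lemma convex_fun_onD:
  fixes k :: nat
  assumes "convex_fun_on S f" "\<And>i. i \<in> {1..k} \<Longrightarrow> 0 \<le> l i" "\<And>i. i \<in> {1..k} \<Longrightarrow> y i \<in> S"
    "(\<Sum>i=1..k. l i) = 1" "(\<Sum>i=1..k. l i *\<^sub>R y i) \<in> S"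
  shows "f (\<Sum>i=1..k. l i *\<^sub>R y i) \<le> (\<Sum>i=1..k. l i * f (y i))"
  using assms(1)[unfolded convex_fun_on_def, rule_format, of k l y "\<Sum>i=1..k. l i *\<^sub>R y i"] assms(2-)
  by simp

lemma strict_convex_fun_onD:
  fixes k :: nat
  assumes "strict_convex_fun_on S f"
    "\<And>i. i \<in> {1..k} \<Longrightarrow> 0 \<le> l i" "\<And>i. i \<in> {1..k} \<Longrightarrow> y i \<in> S"
    "(\<Sum>i=1..k. l i) = 1" "(\<Sum>i=1..k. l i *\<^sub>R y i) \<in> S"
    "\<And>i. i \<in> {1..k} \<Longrightarrow> y i \<noteq> (\<Sum>i=1..k. l i *\<^sub>R y i)"
  shows "f (\<Sum>i=1..k. l i *\<^sub>R y i) < (\<Sum>i=1..k. l i * f (y i))"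
  using assms(1)[unfolded strict_convex_fun_on_def, THEN conjunct2, rule_format,
      of k l y "\<Sum>i=1..k. l i *\<^sub>R y i"] assms(2-)
  by simp

lemma convex_fun_on_subset:
  assumes "convex_fun_on S f" "T \<subseteq> S"
  shows "convex_fun_on T f"
  unfolding convex_fun_on_def
proof (intro allI impI, elim conjE, goal_cases)
  case (1 k l y x)
  then show ?case
    unfolding 1(3) by (intro convex_fun_onD[OF assms(1)]) (use assms(2) in auto)
qed

lemma strict_convex_fun_on_subset:
  assumes "strict_convex_fun_on S f" "T \<subseteq> S"
  shows "strict_convex_fun_on T f"
  unfolding strict_convex_fun_on_def
proof (intro conjI allI impI, goal_cases)
  case 1
  show ?case
    using assms convex_fun_on_subset unfolding strict_convex_fun_on_def by blast
next
  case (2 k l y x)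
  then have x: "x = (\<Sum>i=1..k. l i *\<^sub>R y i)" by simp
  show ?case
    using 2 unfolding x by (intro strict_convex_fun_onD[OF assms(1)]) (use assms(2) in auto)
qed

lemma strict_convex_fun_on_imp_convex: "strict_convex_fun_on S f \<Longrightarrow> convex_fun_on S f"
  by (simp add: strict_convex_fun_on_def)

section \<open>Two-point inequalities, and their sufficiency on convex domains\<close>

lemma convex_fun_on_2:
  assumes "convex_fun_on S f" "a \<in> S" "b \<in> S" "0 \<le> u" "u \<le> 1" "(1 - u) *\<^sub>R a + u *\<^sub>R b \<in> S"
  shows "f ((1 - u) *\<^sub>R a + u *\<^sub>R b) \<le> (1 - u) * f a + u * f b"
proof -
  have "f (\<Sum>i=1..(2::nat). (if i = 1 then 1 - u else u) *\<^sub>R (if i = 1 then a else b))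
    \<le> (\<Sum>i=1..(2::nat). (if i = 1 then 1 - u else u) * f (if i = 1 then a else b))"
    by (rule convex_fun_onD[OF assms(1), of 2 "\<lambda>i. if i = 1 then 1 - u else u" "\<lambda>i. if i = 1 then a else b"]) (use assms in \<open>auto simp: numeral_2_eq_2\<close>)
  then show ?thesis by (simp add: numeral_2_eq_2)
qed

lemma strict_convex_fun_on_2:
  assumes "strict_convex_fun_on S f" "a \<in> S" "b \<in> S" "a \<noteq> b" "0 < u" "u < 1"
    "(1 - u) *\<^sub>R a + u *\<^sub>R b \<in> S"
  shows "f ((1 - u) *\<^sub>R a + u *\<^sub>R b) < (1 - u) * f a + u * f b"
proof -
  have ne: "a \<noteq> (1 - u) *\<^sub>R a + u *\<^sub>R b" "b \<noteq> (1 - u) *\<^sub>R a + u *\<^sub>R b"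
  proof -
    have "(1 - u) *\<^sub>R a + u *\<^sub>R b - a = u *\<^sub>R (b - a)" "(1 - u) *\<^sub>R a + u *\<^sub>R b - b = (1 - u) *\<^sub>R (a - b)"
      by (simp_all add: algebra_simps)
    then show "a \<noteq> (1 - u) *\<^sub>R a + u *\<^sub>R b" "b \<noteq> (1 - u) *\<^sub>R a + u *\<^sub>R b"
      using assms by auto
  qed
  have "f (\<Sum>i=1..(2::nat). (if i = 1 then 1 - u else u) *\<^sub>R (if i = 1 then a else b))
    < (\<Sum>i=1..(2::nat). (if i = 1 then 1 - u else u) * f (if i = 1 then a else b))"
    by (rule strict_convex_fun_onD[OF assms(1), of 2 "\<lambda>i. if i = 1 then 1 - u else u" "\<lambda>i. if i = 1 then a else b"]) (use assms ne in \<open>auto simp: numeral_2_eq_2\<close>)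
  then show ?thesis by (simp add: numeral_2_eq_2)
qed

lemma convex_fun_on_iff_convex_on:
  assumes "convex S"
  shows "convex_fun_on S f \<longleftrightarrow> convex_on S f"
proof
  assume f: "convex_fun_on S f"
  show "convex_on S f"
    by (rule convex_onI)
      (use assms in \<open>auto intro!: convex_fun_on_2[OF f] simp: convex_alt\<close>)
next
  assume f: "convex_on S f"
  show "convex_fun_on S f"
    unfolding convex_fun_on_def
  proof (intro allI impI, elim conjE)
    fix k :: nat and l :: "nat \<Rightarrow> real" and y x
    assume *: "\<forall>i\<in>{1..k}. 0 \<le> l i \<and> y i \<in> S" "(\<Sum>i=1..k. l i) = 1"
      "x = (\<Sum>i=1..k. l i *\<^sub>R y i)" "x \<in> S"
    \<comment> \<open>The case \<open>k = 0\<close> is excluded by the total weight 1; Jensen's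
      inequality needs a nonempty index set.\<close>
    then have "{1..k} \<noteq> {}" by force
    then show "f x \<le> (\<Sum>i=1..k. l i * f (y i))"
      unfolding *(3) by (intro convex_on_sum[OF _ _ f]) (use * in auto)
  qed
qed

text \<open>One point \<open>y i\<close> of nonzero weight is split off and the others are averaged
  to \<open>w\<close>. The strict inequality for the pair \<open>w\<close>, \<open>y i\<close>
  combines with Jensen's inequality at \<open>w\<close>, so no induction on \<open>k\<close> is
  needed.\<close>

lemma strict_convex_fun_onI_2:
  assumes f: "convex_on S f"
    and strict: "\<And>a b u. \<lbrakk>a \<in> S; b \<in> S; a \<noteq> b; 0 < u; u < 1\<rbrakk>
      \<Longrightarrow> f ((1 - u) *\<^sub>R a + u *\<^sub>R b) < (1 - u) * f a + u * f b"
  shows "strict_convex_fun_on S f"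
  unfolding strict_convex_fun_on_def
proof (intro conjI allI impI, goal_cases)
  case 1
  show ?case
    using f convex_fun_on_iff_convex_on convex_on_imp_convex by blast
next
  case (2 k l y x)
  then have l: "\<And>i. i \<in> {1..k} \<Longrightarrow> 0 \<le> l i" and y: "\<And>i. i \<in> {1..k} \<Longrightarrow> y i \<in> S"
    and sum1: "(\<Sum>i=1..k. l i) = 1" and x: "x = (\<Sum>i=1..k. l i *\<^sub>R y i)"
    and ne: "\<And>i. i \<in> {1..k} \<Longrightarrow> y i \<noteq> x"
    by auto
  obtain i where i: "i \<in> {1..k}" "l i \<noteq> 0"
    using sum1 by (metis sum.neutral zero_neq_one)
  define J where "J = {1..k} - {i}"
  have J: "finite J" and split: "(\<Sum>j=1..k. g j) = g i + sum g J" for g :: "nat \<Rightarrow> 'b::comm_monoid_add"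
    using i(1) by (auto simp: J_def sum.remove)
  have sumJ: "sum l J = 1 - l i" using sum1 split[of l] by simp
  have lJ: "0 \<le> l j" "y j \<in> S" if "j \<in> J" for j using that l y by (auto simp: J_def)
  \<comment> \<open>Full weight at \<open>i\<close> would give \<open>x = y i\<close>. Excluding it
    allows division by \<open>1 - l i\<close>.\<close>
  have "l i \<noteq> 1"
  proof
    assume "l i = 1"
    then have "\<forall>j\<in>J. l j = 0"
      using sumJ lJ J by (simp add: sum_nonneg_eq_0_iff)
    then have "x = y i" using x split[of "\<lambda>j. l j *\<^sub>R y j"] \<open>l i = 1\<close> by simp
    then show False using ne i by auto
  qed
  moreover have "0 \<le> sum l J" by (intro sum_nonneg lJ)
  ultimately have li: "0 < l i" "l i < 1" using i l[of i] sumJ by auto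
  define m where "m = (\<lambda>j. l j / (1 - l i))"
  have m: "\<And>j. j \<in> J \<Longrightarrow> 0 \<le> m j" "sum m J = 1"
    using lJ li sumJ by (auto simp: m_def sum_divide_distrib[symmetric])
  define w where "w = (\<Sum>j\<in>J. m j *\<^sub>R y j)"
  have w: "w \<in> S"
    unfolding w_def
    by (rule convex_sum[OF J convex_on_imp_convex[OF f]]) (use m lJ in auto)
  have "J \<noteq> {}" using m(2) by auto
  then have fw: "f w \<le> (\<Sum>j\<in>J. m j * f (y j))"
    unfolding w_def by (rule convex_on_sum[OF J _ f]) (use m lJ in auto)
  have lm: "l j = (1 - l i) * m j" for j using li by (simp add: m_def)
  have xw: "x = (1 - l i) *\<^sub>R w + l i *\<^sub>R y i"
    unfolding x split[of "\<lambda>j. l j *\<^sub>R y j"] w_def scaleR_sum_right scaleR_scaleR lm[symmetric] by simp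
  have "w \<noteq> y i"
  proof
    assume "w = y i"
    then have "x = y i" using xw by (simp add: algebra_simps)
    then show False using ne i by auto
  qed
  then have "f x < (1 - l i) * f w + l i * f (y i)"
    unfolding xw using strict w y[OF i(1)] li by blast
  also have "\<dots> \<le> (1 - l i) * (\<Sum>j\<in>J. m j * f (y j)) + l i * f (y i)"
    using fw li by simp
  also have "\<dots> = (\<Sum>j=1..k. l j * f (y j))"
    unfolding split[of "\<lambda>j. l j * f (y j)"] sum_distrib_left mult.assoc[symmetric] lm[symmetric] by simp
  finally show ?case .
qed

subsection \<open>Local convexity and interval convexity\<close>

text \<open>Pulled back along the affine parametrization \<open>\<gamma>\<close> of the segment,
  local convexity becomes local convexity on \<open>{0..1}\<close>, which is global by
  \<open>convex_on_Icc_local\<close>.\<close>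

lemma locally_imp_interval_convex:
  assumes "locally_convex_fun_on S f"
  shows "interval_convex_fun_on S f"
  unfolding interval_convex_fun_on_def
proof (intro allI impI)
  fix a b assume sub: "closed_segment a b \<subseteq> S"
  define \<gamma> where "\<gamma> = (\<lambda>t. (1 - t) *\<^sub>R a + t *\<^sub>R b)"
  have seg: "closed_segment a b = \<gamma> ` {0..1}"
    by (simp add: \<gamma>_def closed_segment_image_interval)
  have aff: "\<gamma> ((1 - u) * s + u * t) = (1 - u) *\<^sub>R \<gamma> s + u *\<^sub>R \<gamma> t" for u s t
    by (simp add: \<gamma>_def algebra_simps)
  have "convex_on {0..1} (f \<circ> \<gamma>)"
  proof (rule convex_on_Icc_local)
    fix s :: real assume s: "s \<in> {0..1}"
    then have "\<gamma> s \<in> S" using sub seg by auto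
    then obtain r where r: "r > 0" "convex_fun_on (ball (\<gamma> s) r \<inter> S) f"
      using assms unfolding locally_convex_fun_on_def by blast
    \<comment> \<open>\<open>\<gamma>\<close> has Lipschitz constant \<open>norm (b - a)\<close>;
      adding 1 keeps the denominator positive when \<open>a = b\<close>.\<close>
    define d where "d = r / (norm (b - a) + 1)"
    have pos: "norm (b - a) + 1 > 0" by (smt (verit) norm_ge_zero)
    then have d: "d > 0" using r by (simp add: d_def)
    have mem: "\<gamma> t \<in> ball (\<gamma> s) r \<inter> S" if "t \<in> {s-d<..<s+d} \<inter> {0..1}" for t
    proof -
      have "\<gamma> s - \<gamma> t = (s - t) *\<^sub>R (b - a)" by (simp add: \<gamma>_def algebra_simps)
      then have "dist (\<gamma> s) (\<gamma> t) = \<bar>s - t\<bar> * norm (b - a)"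
        by (simp add: dist_norm)
      also have "\<dots> \<le> \<bar>s - t\<bar> * (norm (b - a) + 1)" by (simp add: mult_left_mono)
      also have "\<dots> < d * (norm (b - a) + 1)"
        using that pos by (intro mult_strict_right_mono) auto
      also have "\<dots> = r" using pos by (simp add: d_def)
      finally show ?thesis using that sub seg by auto
    qed
    let ?I = "{s-d<..<s+d} \<inter> {0..1}"
    have cv: "convex ?I" by (intro convex_Int) auto
    have "convex_on ?I (f \<circ> \<gamma>)"
    proof (rule convex_onI[OF _ cv])
      fix u x y :: real assume u: "0 < u" "u < 1" and xy: "x \<in> ?I" "y \<in> ?I"
      then have "(1 - u) * x + u * y \<in> ?I"
        using cv unfolding convex_alt by (metis less_eq_real_def real_scaleR_def)
      then have "\<gamma> ((1 - u) * x + u * y) \<in> ball (\<gamma> s) r \<inter> S" by (rule mem)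
      then show "(f \<circ> \<gamma>) ((1 - u) *\<^sub>R x + u *\<^sub>R y) \<le> (1 - u) * (f \<circ> \<gamma>) x + u * (f \<circ> \<gamma>) y"
        using convex_fun_on_2[OF r(2) mem[OF xy(1)] mem[OF xy(2)], of u] u by (simp add: aff)
    qed
    then show "\<exists>d>0. convex_on ({s-d<..<s+d} \<inter> {0..1}) (f \<circ> \<gamma>)" using d by blast
  qed simp
  then have "convex_on (closed_segment a b) f"
  proof (intro convex_onI)
    fix u :: real and p q assume u: "0 < u" "u < 1" and "p \<in> closed_segment a b" "q \<in> closed_segment a b"
    then obtain s t where st: "s \<in> {0..1}" "t \<in> {0..1}" "p = \<gamma> s" "q = \<gamma> t"
      unfolding seg by blast
    then show "f ((1 - u) *\<^sub>R p + u *\<^sub>R q) \<le> (1 - u) * f p + u * f q"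
      using convex_onD[OF \<open>convex_on {0..1} (f \<circ> \<gamma>)\<close>, of u s t] u by (simp add: aff)
  qed simp
  then show "convex_fun_on (closed_segment a b) f"
    by (simp add: convex_fun_on_iff_convex_on)
qed

section \<open>Interval convexity on convex subsets of the domain\<close>

lemma convex_comb_in_segment: "0 \<le> t \<Longrightarrow> t \<le> 1 \<Longrightarrow> (1 - t) *\<^sub>R a + t *\<^sub>R b \<in> closed_segment a b"
  unfolding in_segment by blast

lemma interval_convex_imp_convex_on:
  assumes f: "interval_convex_fun_on S f" and C: "C \<subseteq> S" "convex C"
  shows "convex_on C f"
proof (rule convex_onI)
  fix t :: real and x y assume t: "0 < t" "t < 1" "x \<in> C" "y \<in> C"
  then have "convex_fun_on (closed_segment x y) f"
    using f C unfolding interval_convex_fun_on_def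
    by (meson closed_segment_subset subset_trans)
  then show "f ((1 - t) *\<^sub>R x + t *\<^sub>R y) \<le> (1 - t) * f x + t * f y"
    by (rule convex_fun_on_2) (use t convex_comb_in_segment[of t x y] in auto)
qed fact

lemma strict_interval_imp_interval:
  "strict_interval_convex_fun_on S f \<Longrightarrow> interval_convex_fun_on S f"
  unfolding strict_interval_convex_fun_on_def interval_convex_fun_on_def
  using strict_convex_fun_on_imp_convex by blast

lemma strict_locally_imp_locally:
  "strict_locally_convex_fun_on S f \<Longrightarrow> locally_convex_fun_on S f"
  unfolding strict_locally_convex_fun_on_def locally_convex_fun_on_def
  using strict_convex_fun_on_imp_convex by blast

lemma strict_interval_imp_strict_convex:
  assumes f: "strict_interval_convex_fun_on S f" and C: "C \<subseteq> S" "convex C"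
  shows "strict_convex_fun_on C f"
proof (rule strict_convex_fun_onI_2)
  show "convex_on C f"
    using interval_convex_imp_convex_on[OF strict_interval_imp_interval[OF f] C] .
  fix x y t assume t: "x \<in> C" "y \<in> C" "x \<noteq> y" "0 < (t::real)" "t < 1"
  then have "strict_convex_fun_on (closed_segment x y) f"
    using f C unfolding strict_interval_convex_fun_on_def
    by (meson closed_segment_subset subset_trans)
  then show "f ((1 - t) *\<^sub>R x + t *\<^sub>R y) < (1 - t) * f x + t * f y"
    by (rule strict_convex_fun_on_2) (use t convex_comb_in_segment[of t x y] in auto)
qed

lemma ball_avoiding_closed:
  fixes A :: "'a::metric_space set"
  assumes "closed A" "x \<notin> A"
  obtains r where "r > 0" "ball x r \<inter> A = {}"
  using assms open_contains_ball[of "- A"] by (force simp: open_Compl)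

text \<open>Near a point off the closed set \<open>A\<close>, the domain coincides with
  \<open>\<Omega>\<close> and is therefore convex, so segments between nearby points stay in
  it.\<close>

lemma strict_interval_imp_strict_locally_convex:
  fixes \<Omega> :: "'a::real_normed_vector set"
  assumes "convex \<Omega>" "closed A" "strict_interval_convex_fun_on (\<Omega> - A) f"
  shows "strict_locally_convex_fun_on (\<Omega> - A) f"
  unfolding strict_locally_convex_fun_on_def
proof
  fix x assume "x \<in> \<Omega> - A"
  then obtain r where r: "r > 0" "ball x r \<inter> A = {}"
    using ball_avoiding_closed assms(2) by blast
  then have "ball x r \<inter> (\<Omega> - A) = ball x r \<inter> \<Omega>" by auto
  then have "strict_convex_fun_on (ball x r \<inter> (\<Omega> - A)) f"
    by (metis strict_interval_imp_strict_convex[OF assms(3)] inf_le2 convex_Int convex_ball assms(1))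
  then show "\<exists>r>0. strict_convex_fun_on (ball x r \<inter> (\<Omega> - A)) f" using r(1) by blast
qed

section \<open>Propagating strictness by contraction\<close>

lemma small_contraction:
  fixes y :: "nat \<Rightarrow> 'a::real_normed_vector"
  assumes "finite I" "r > 0"
  obtains t where "0 < t" "t < 1" "\<And>i. i \<in> I \<Longrightarrow> t * norm (y i - x) < r"
proof -
  define N where "N = (\<Sum>i\<in>I. norm (y i - x))"
  have N: "0 \<le> N" "\<And>i. i \<in> I \<Longrightarrow> norm (y i - x) \<le> N"
    using assms(1) by (auto simp: N_def intro: sum_nonneg member_le_sum)
  show thesis
  \<comment> \<open>Since \<open>N\<close> bounds all the norms, this factor makes every product
    less than \<open>r\<close>; the summand \<open>r\<close> keeps it below 1 and the summand 1
    makes the bound strict.\<close>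
  proof (rule that[of "r / (r + N + 1)"])
    fix i assume "i \<in> I"
    then have "norm (y i - x) < r + N + 1" using N(2)[of i] assms(2) by linarith
    then have "r * norm (y i - x) < r * (r + N + 1)" using assms(2) by simp
    then show "r / (r + N + 1) * norm (y i - x) < r"
      using N(1) assms(2) by (simp add: pos_divide_less_eq)
  qed (use N(1) assms(2) in auto)
qed

text \<open>Contracting all \<open>y i\<close> towards \<open>x\<close> preserves their weighted
  mean \<open>x\<close> and brings them into a ball of strict convexity. Ordinary convexity then
  bounds the values at the contracted points by those at \<open>x\<close> and
  \<open>y i\<close>.\<close>

lemma strict_locally_and_convex_imp_strict_convex:
  fixes \<Omega> :: "'a::real_normed_vector set"
  assumes "convex \<Omega>" "closed A" "convex_fun_on (\<Omega> - A) f" "strict_locally_convex_fun_on (\<Omega> - A) f"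
  shows "strict_convex_fun_on (\<Omega> - A) f"
  unfolding strict_convex_fun_on_def
proof (intro conjI allI impI, goal_cases)
  case 1
  show ?case by fact
next
  case (2 k l y x)
  then have l: "\<And>i. i \<in> {1..k} \<Longrightarrow> 0 \<le> l i" and y: "\<And>i. i \<in> {1..k} \<Longrightarrow> y i \<in> \<Omega> - A"
    and sum1: "(\<Sum>i=1..k. l i) = 1" and x: "x = (\<Sum>i=1..k. l i *\<^sub>R y i)" and xS: "x \<in> \<Omega> - A"
    and ne: "\<And>i. i \<in> {1..k} \<Longrightarrow> y i \<noteq> x"
    by auto
  obtain r where r: "r > 0" "strict_convex_fun_on (ball x r \<inter> (\<Omega> - A)) f"
    using assms(4) xS unfolding strict_locally_convex_fun_on_def by metis
  \<comment> \<open>The radius \<open>s\<close> keeps the contracted points off \<open>A\<close>,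
    although the segments from \<open>x\<close> to the \<open>y i\<close> may meet
    \<open>A\<close>.\<close>
  obtain s where s: "s > 0" "ball x s \<inter> A = {}"
    using ball_avoiding_closed assms(2) xS by blast
  obtain t where t: "0 < t" "t < 1" and ty: "\<And>i. i \<in> {1..k} \<Longrightarrow> t * norm (y i - x) < min r s"
    using small_contraction[of "{1..k}" "min r s" y x] r s by auto
  define z where "z i = (1 - t) *\<^sub>R x + t *\<^sub>R y i" for i
  have zS: "z i \<in> ball x r \<inter> (\<Omega> - A)" and zne: "z i \<noteq> x" if "i \<in> {1..k}" for i
  proof -
    have zx: "z i - x = t *\<^sub>R (y i - x)" by (simp add: z_def algebra_simps)
    then have "dist x (z i) = t * norm (y i - x)"
      using t by (metis abs_of_pos dist_commute dist_norm norm_scaleR)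
    then have "dist x (z i) < r" "dist x (z i) < s" using ty[OF that] by auto
    moreover have "z i \<in> \<Omega>"
      using assms(1) xS y[OF that] t unfolding z_def convex_alt by simp
    ultimately show "z i \<in> ball x r \<inter> (\<Omega> - A)" using s by auto
    show "z i \<noteq> x" using zx ne[OF that] t by auto
  qed
  have "(\<Sum>i=1..k. l i *\<^sub>R z i) = (\<Sum>i=1..k. (1 - t) *\<^sub>R (l i *\<^sub>R x) + t *\<^sub>R (l i *\<^sub>R y i))"
    by (simp add: z_def scaleR_add_right mult.commute)
  also have "\<dots> = (1 - t) *\<^sub>R ((\<Sum>i=1..k. l i) *\<^sub>R x) + t *\<^sub>R x"
    by (simp only: sum.distrib scaleR_sum_right[symmetric] scaleR_sum_left[symmetric] x[symmetric])
  also have "\<dots> = x" unfolding sum1 by (simp add: algebra_simps)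
  finally have xz: "(\<Sum>i=1..k. l i *\<^sub>R z i) = x" .
  have xB: "x \<in> ball x r \<inter> (\<Omega> - A)" using xS r(1) by simp
  have "f x < (\<Sum>i=1..k. l i * f (z i))"
    by (rule strict_convex_fun_onD[OF r(2), of k l z, unfolded xz],
        erule l, erule zS, rule sum1, rule xB, erule zne)
  \<comment> \<open>Two-point convexity on \<open>\<Omega> - A\<close> requires only that
    \<open>z i\<close> itself is off \<open>A\<close>, not the whole segment.\<close>
  also have "\<dots> \<le> (\<Sum>i=1..k. l i * ((1 - t) * f x + t * f (y i)))"
  proof (intro sum_mono mult_left_mono l)
    fix i assume i: "i \<in> {1..k}"
    then show "f (z i) \<le> (1 - t) * f x + t * f (y i)"
      using convex_fun_on_2[OF assms(3) xS y[OF i], of t] zS[OF i] t by (simp add: z_def)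
  qed
  also have "\<dots> = (\<Sum>i=1..k. (1 - t) * f x * l i + t * (l i * f (y i)))"
    by (intro sum.cong) (simp_all add: algebra_simps)
  also have "\<dots> = (1 - t) * f x + t * (\<Sum>i=1..k. l i * f (y i))"
    by (simp only: sum.distrib sum_distrib_left[symmetric] sum1 mult_1_right)
  finally have "t * f x < t * (\<Sum>i=1..k. l i * f (y i))" by (simp add: algebra_simps)
  then show ?case using t by simp
qed

lemma strict_locally_imp_strict_interval_convex:
  assumes "strict_locally_convex_fun_on S f"
  shows "strict_interval_convex_fun_on S f"
  unfolding strict_interval_convex_fun_on_def
proof (intro allI impI)
  fix a b assume sub: "closed_segment a b \<subseteq> S"
  have "strict_locally_convex_fun_on (closed_segment a b) f"
    using assms sub unfolding strict_locally_convex_fun_on_def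
    by (meson Int_mono order_refl strict_convex_fun_on_subset subsetD)
  moreover have "convex_fun_on (closed_segment a b) f"
    using locally_imp_interval_convex[OF strict_locally_imp_locally[OF assms]] sub
    unfolding interval_convex_fun_on_def by blast
  \<comment> \<open>The segment takes the role of \<open>\<Omega>\<close>, with nothing
    removed.\<close>
  ultimately show "strict_convex_fun_on (closed_segment a b) f"
    using strict_locally_and_convex_imp_strict_convex[of "closed_segment a b" "{}"] by simp
qed

subsection \<open>From interval convexity to convexity\<close>

text \<open>A relative ball in \<open>T\<close> need not be open in the whole space. Composing
  \<open>f\<close> with the affine projection \<open>y \<mapsto> x + P (y - x)\<close> onto
  \<open>T\<close> gives a convex function on an open ball, hence a continuous one, which agrees
  with \<open>f\<close> on \<open>T\<close>.\<close>

lemma convex_on_affine_continuous: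
  fixes f :: "'a::euclidean_space \<Rightarrow> real"
  assumes "affine T" "x \<in> T" "r > 0" and f: "convex_on (ball x r \<inter> T) f"
  shows "continuous (at x within T) f"
proof -
  define V where "V = (\<lambda>y. y - x) ` T"
  have "subspace V" unfolding V_def by (rule affine_diffs_subspace_subtract[OF assms(1,2)])
  \<comment> \<open>A left inverse of the identity on \<open>V\<close> with range in
    \<open>V\<close> is a linear projection onto \<open>V\<close>.\<close>
  then obtain P where P: "range P \<subseteq> V" "linear P" "\<And>v. v \<in> V \<Longrightarrow> P v = v"
    using linear_exists_left_inverse_on[OF linear_ident, of V] by auto
  obtain K where K: "K > 0" "\<And>v. norm (P v) \<le> K * norm v"
    using linear_bounded_pos[OF P(2)] by blast
  have mem: "x + P v \<in> ball x r \<inter> T" if "v \<in> ball 0 (r / K)" for v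
  proof -
    have "norm (P v) \<le> K * norm v" by (rule K)
    also have "\<dots> < r" using that K(1) by (simp add: field_simps)
    finally have "norm (P v) < r" .
    moreover have "P v \<in> V" using P(1) by auto
    then have "x + P v \<in> T" by (auto simp: V_def)
    ultimately show ?thesis by (simp add: dist_norm)
  qed
  have "convex_on (ball 0 (r / K)) (\<lambda>v. f (x + P v))"
  proof (rule convex_onI)
    fix t :: real and v w :: 'a assume t: "0 < t" "t < 1" "v \<in> ball 0 (r / K)" "w \<in> ball 0 (r / K)"
    have "x + P ((1 - t) *\<^sub>R v + t *\<^sub>R w) = (1 - t) *\<^sub>R (x + P v) + t *\<^sub>R (x + P w)"
      by (simp add: linear_add[OF P(2)] linear_scale[OF P(2)]) (simp add: algebra_simps)
    then show "f (x + P ((1 - t) *\<^sub>R v + t *\<^sub>R w)) \<le> (1 - t) * f (x + P v) + t * f (x + P w)"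
      using convex_onD[OF f _ _ mem[OF t(3)] mem[OF t(4)], of t] t by simp
  qed simp
  then have "continuous_on (ball 0 (r / K)) (\<lambda>v. f (x + P v))"
    by (intro convex_on_continuous) auto
  then have "isCont (\<lambda>v. f (x + P v)) 0"
    using assms(3) K(1) by (simp add: continuous_on_eq_continuous_at)
  then have "isCont (\<lambda>y. f (x + P (y - x))) x"
    by (intro continuous_at_compose[of x "\<lambda>y. y - x" "\<lambda>v. f (x + P v)", unfolded o_def]) auto
  then have "continuous (at x within T) (\<lambda>y. f (x + P (y - x)))"
    by (rule continuous_at_imp_continuous_at_within)
  then show ?thesis
  proof (rule continuous_transform_within)
    show "f (x + P (y - x)) = f y" if "y \<in> T" for y
      using P(3)[of "y - x"] that by (auto simp: V_def)
  qed (use assms in auto)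
qed

text \<open>The compact segment has positive distance from \<open>A\<close>, and moving one endpoint
  moves no point of the segment, at a fixed parameter, farther than that endpoint.\<close>

lemma closed_segment_avoids_closed_stable:
  fixes A :: "'a::euclidean_space set"
  assumes "closed A" "closed_segment y x \<inter> A = {}"
  obtains d where "d > 0" "\<And>x'. dist x' x < d \<Longrightarrow> closed_segment y x' \<inter> A = {}"
proof -
  obtain d where d: "d > 0" "\<And>p q. \<lbrakk>p \<in> closed_segment y x; q \<in> A\<rbrakk> \<Longrightarrow> d \<le> dist p q"
    using separate_compact_closed[OF compact_segment assms] by blast
  have "closed_segment y x' \<inter> A = {}" if "dist x' x < d" for x'
  proof (rule ccontr)
    assume "closed_segment y x' \<inter> A \<noteq> {}"
    then obtain u where u: "0 \<le> u" "u \<le> 1" "(1 - u) *\<^sub>R y + u *\<^sub>R x' \<in> A"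
      by (auto simp: in_segment)
    have "((1 - u) *\<^sub>R y + u *\<^sub>R x) - ((1 - u) *\<^sub>R y + u *\<^sub>R x') = u *\<^sub>R (x - x')"
      by (simp add: algebra_simps)
    then have "dist ((1 - u) *\<^sub>R y + u *\<^sub>R x) ((1 - u) *\<^sub>R y + u *\<^sub>R x') = u * dist x' x"
      using u by (simp add: dist_norm norm_minus_commute)
    also have "\<dots> \<le> dist x' x" using u by (simp add: mult_left_le_one_le)
    finally show False
      using d(2)[of "(1 - u) *\<^sub>R y + u *\<^sub>R x", OF _ u(3)] that u by (force simp: in_segment)
  qed
  then show thesis using that d(1) by blast
qed

text \<open>The points of \<open>F\<close> are treated one after another: each move makes one more
  segment avoid \<open>A\<close> and is small enough to keep the segments already obtained off
  \<open>A\<close>.\<close>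

lemma general_position_finite:
  assumes "general_position_codim_two \<Omega> A" "closed A" "finite F" "F \<subseteq> \<Omega> - A" "x \<in> \<Omega> - A" "e > 0"
  shows "\<exists>x'\<in>\<Omega> - A. dist x' x < e \<and> (\<forall>y\<in>F. closed_segment y x' \<inter> A = {})"
  using assms(3,4,6)
proof (induction F arbitrary: e rule: finite_induct)
  case empty
  then show ?case using assms(5) by (intro bexI[of _ x]) auto
next
  case (insert y F)
  then obtain x' where x': "x' \<in> \<Omega> - A" "dist x' x < e / 2" "\<And>z. z \<in> F \<Longrightarrow> closed_segment z x' \<inter> A = {}"
    by (metis half_gt_zero insert_subset)
  \<comment> \<open>A common stability radius for the finitely many segments obtained so
    far.\<close>
  have "\<exists>d>0. \<forall>z\<in>F. \<forall>x''. dist x'' x' < d \<longrightarrow> closed_segment z x'' \<inter> A = {}"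
    using insert.hyps(1) x'(3)
  proof (induction F rule: finite_induct)
    case empty
    show ?case by (intro exI[of _ 1]) auto
  next
    case (insert z F)
    then obtain d where "d > 0" "\<forall>z\<in>F. \<forall>x''. dist x'' x' < d \<longrightarrow> closed_segment z x'' \<inter> A = {}"
      by blast
    moreover obtain d' where "d' > 0" "\<And>x''. dist x'' x' < d' \<Longrightarrow> closed_segment z x'' \<inter> A = {}"
      using closed_segment_avoids_closed_stable[OF assms(2) insert.prems[of z]] by blast
    ultimately show ?case by (intro exI[of _ "min d d'"]) auto
  qed
  then obtain d where d: "d > 0" "\<And>z x''. \<lbrakk>z \<in> F; dist x'' x' < d\<rbrakk> \<Longrightarrow> closed_segment z x'' \<inter> A = {}"
    by blast
  have "y \<in> \<Omega> - A" "min d (e / 2) > 0" using insert.prems d by auto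
  then obtain x'' where x'': "x'' \<in> \<Omega>" "dist x'' x' < min d (e / 2)" "closed_segment y x'' \<inter> A = {}"
    using assms(1) x'(1) unfolding general_position_codim_two_def by meson
  have "x'' \<notin> A" using x''(3) by auto
  moreover have "dist x'' x < e"
    using x'(2) x''(2) dist_triangle[of x'' x x'] by simp
  ultimately show ?case using x'' d(2) by (intro bexI[of _ x'']) auto
qed

text \<open>A violation \<open>M < f x\<close> leaves the gap \<open>t * (f x - M)\<close> after
  contraction. Continuity makes the error from replacing \<open>x\<close> by \<open>x'\<close>
  smaller than this gap, a contradiction.\<close>

lemma interval_convex_at_rel_interior:
  fixes \<Omega> :: "'a::euclidean_space set" and k :: nat
  assumes "convex \<Omega>" "closed A" "general_position_codim_two \<Omega> A"
    and f: "interval_convex_fun_on (\<Omega> - A) f"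
    and l: "\<And>i. i \<in> {1..k} \<Longrightarrow> 0 \<le> l i" and y: "\<And>i. i \<in> {1..k} \<Longrightarrow> y i \<in> \<Omega> - A"
    and sum1: "(\<Sum>i=1..k. l i) = 1" and x: "x = (\<Sum>i=1..k. l i *\<^sub>R y i)"
    and xr: "x \<in> rel_interior \<Omega>" "x \<notin> A"
  shows "f x \<le> (\<Sum>i=1..k. l i * f (y i))"
proof (rule ccontr)
  define M where "M = (\<Sum>i=1..k. l i * f (y i))"
  assume "\<not> f x \<le> (\<Sum>i=1..k. l i * f (y i))"
  then have M: "M < f x" by (simp add: M_def)
  have x\<Omega>: "x \<in> \<Omega>" using xr rel_interior_subset by blast
  obtain r1 where r1: "r1 > 0" "ball x r1 \<inter> affine hull \<Omega> \<subseteq> \<Omega>"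
    using xr unfolding mem_rel_interior_ball by blast
  obtain r2 where r2: "r2 > 0" "ball x r2 \<inter> A = {}"
    using ball_avoiding_closed assms(2) xr by blast
  define r where "r = min r1 r2"
  have r: "r > 0" "ball x r \<inter> affine hull \<Omega> \<subseteq> \<Omega> - A"
    using r1 r2 by (auto simp: r_def)
  \<comment> \<open>Here the relative interior enters: \<open>C\<close> is a convex relative
    neighbourhood of \<open>x\<close> inside \<open>\<Omega> - A\<close>, so \<open>f\<close> is
    convex on it.\<close>
  define C where "C = ball x r \<inter> affine hull \<Omega>"
  have C\<Omega>: "z \<in> C" if "z \<in> \<Omega>" "dist z x < r" for z
    using that by (simp add: C_def hull_inc dist_commute)
  have convC: "convex C" unfolding C_def by (intro convex_Int) (auto simp: affine_imp_convex)
  have fC: "convex_on C f"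
    by (rule interval_convex_imp_convex_on[OF f _ convC]) (use r C_def in auto)
  have cont: "continuous (at x within affine hull \<Omega>) f"
    by (rule convex_on_affine_continuous[OF affine_affine_hull _ r(1)])
      (use fC x\<Omega> in \<open>auto simp: C_def hull_inc\<close>)
  \<comment> \<open>The factor \<open>t\<close> is fixed before \<open>x'\<close>, since the
    tolerance \<open>\<epsilon>\<close> depends on it. The bound \<open>r / 2\<close> leaves room
    for a displacement of \<open>x'\<close> by up to \<open>r / 2\<close>.\<close>
  obtain t where t: "0 < t" "t < 1" and ty: "\<And>i. i \<in> {1..k} \<Longrightarrow> t * norm (y i - x) < r / 2"
    using small_contraction[of "{1..k}" "r / 2" y x] r by auto
  define \<epsilon> where "\<epsilon> = t * (f x - M)"
  have \<epsilon>: "\<epsilon> > 0" using t M by (simp add: \<epsilon>_def)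
  then obtain d where d: "d > 0" and fd: "\<And>z. \<lbrakk>z \<in> affine hull \<Omega>; dist z x < d\<rbrakk> \<Longrightarrow> \<bar>f z - f x\<bar> < \<epsilon> / 2"
    using cont unfolding continuous_within_eps_delta dist_real_def by (meson half_gt_zero)
  have "y ` {1..k} \<subseteq> \<Omega> - A" "x \<in> \<Omega> - A" "min d (r / 2) > 0"
    using y x\<Omega> xr d r by auto
  then obtain x' where x': "x' \<in> \<Omega> - A" "dist x' x < min d (r / 2)"
    and seg: "\<And>i. i \<in> {1..k} \<Longrightarrow> closed_segment (y i) x' \<inter> A = {}"
    using general_position_finite[OF assms(3,2), of "y ` {1..k}" x "min d (r / 2)"] by auto
  define z where "z i = (1 - t) *\<^sub>R x' + t *\<^sub>R y i" for i
  have zC: "z i \<in> C" if "i \<in> {1..k}" for i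
  proof (rule C\<Omega>)
    show "z i \<in> \<Omega>" using assms(1) x'(1) y[OF that] t unfolding z_def convex_alt by simp
    have "z i - x = (1 - t) *\<^sub>R (x' - x) + t *\<^sub>R (y i - x)" by (simp add: z_def algebra_simps)
    then have "dist (z i) x \<le> (1 - t) * dist x' x + t * norm (y i - x)"
      using norm_triangle_ineq[of "(1 - t) *\<^sub>R (x' - x)" "t *\<^sub>R (y i - x)"] t
      by (simp add: dist_norm)
    also have "\<dots> \<le> dist x' x + t * norm (y i - x)"
      using t by (simp add: mult_left_le_one_le)
    also have "\<dots> < r" using x'(2) ty[OF that] by simp
    finally show "dist (z i) x < r" .
  qed
  \<comment> \<open>The contraction centred at \<open>x'\<close> sends \<open>x\<close> to
    \<open>w\<close> and \<open>y i\<close> to \<open>z i\<close>; being affine, it preserves the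
    convex combination.\<close>
  define w where "w = (1 - t) *\<^sub>R x' + t *\<^sub>R x"
  have "(\<Sum>i=1..k. l i *\<^sub>R z i) = (\<Sum>i=1..k. (1 - t) *\<^sub>R (l i *\<^sub>R x') + t *\<^sub>R (l i *\<^sub>R y i))"
    by (simp add: z_def scaleR_add_right mult.commute)
  also have "\<dots> = (1 - t) *\<^sub>R ((\<Sum>i=1..k. l i) *\<^sub>R x') + t *\<^sub>R x"
    by (simp only: sum.distrib scaleR_sum_right[symmetric] scaleR_sum_left[symmetric] x[symmetric])
  finally have wz: "w = (\<Sum>i=1..k. l i *\<^sub>R z i)" by (simp only: sum1 w_def scaleR_one)
  have "{1..k} \<noteq> {}" using sum1 by force
  then have "f w \<le> (\<Sum>i=1..k. l i * f (z i))"
    unfolding wz by (intro convex_on_sum[OF _ _ fC]) (use l sum1 zC in auto)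
  also have "\<dots> \<le> (\<Sum>i=1..k. l i * ((1 - t) * f x' + t * f (y i)))"
  proof (intro sum_mono mult_left_mono l)
    fix i assume i: "i \<in> {1..k}"
    have "closed_segment x' (y i) \<subseteq> \<Omega>"
      using x'(1) y[OF i] assms(1) by (intro closed_segment_subset) auto
    then have "closed_segment x' (y i) \<subseteq> \<Omega> - A"
      using seg[OF i] by (auto simp: closed_segment_commute)
    then have "convex_fun_on (closed_segment x' (y i)) f"
      using f unfolding interval_convex_fun_on_def by blast
    then show "f (z i) \<le> (1 - t) * f x' + t * f (y i)"
      unfolding z_def by (rule convex_fun_on_2) (use t convex_comb_in_segment[of t x' "y i"] in auto)
  qed
  also have "\<dots> = (\<Sum>i=1..k. (1 - t) * f x' * l i + t * (l i * f (y i)))"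
    by (intro sum.cong) (simp_all add: algebra_simps)
  also have "\<dots> = (1 - t) * f x' + t * M"
    by (simp only: sum.distrib sum_distrib_left[symmetric] sum1 M_def mult_1_right)
  finally have fw: "f w \<le> (1 - t) * f x' + t * M" .
  have "w - x = (1 - t) *\<^sub>R (x' - x)" by (simp add: w_def algebra_simps)
  then have "dist w x = (1 - t) * dist x' x" using t by (simp add: dist_norm)
  also have "\<dots> \<le> dist x' x" using t by (simp add: mult_left_le_one_le)
  finally have "dist w x < d" using x'(2) by simp
  moreover have "w \<in> \<Omega>" using assms(1) x'(1) x\<Omega> t unfolding w_def convex_alt by simp
  ultimately have "\<bar>f w - f x\<bar> < \<epsilon> / 2" by (intro fd hull_inc)
  moreover have "\<bar>f x' - f x\<bar> < \<epsilon> / 2" using x' by (intro fd hull_inc) auto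
  ultimately have w: "f x - \<epsilon> / 2 < f w" and "f x' < f x + \<epsilon> / 2"
    unfolding abs_less_iff by linarith+
  then have "(1 - t) * f x' \<le> (1 - t) * (f x + \<epsilon> / 2)"
    using t by (intro mult_left_mono) auto
  also have "\<dots> \<le> (1 - t) * f x + \<epsilon> / 2" using t \<epsilon> by (simp add: algebra_simps)
  finally have "(1 - t) * f x' \<le> (1 - t) * f x + \<epsilon> / 2" .
  moreover have "(1 - t) * f x + t * M = f x - \<epsilon>" by (simp add: \<epsilon>_def algebra_simps)
  ultimately show False using fw w by linarith
qed

text \<open>Terms with \<open>y i = x\<close> contribute the same to both sides and are removed. The
  others, renormalized by their total weight \<open>s\<close>, form a proper combination, which
  places \<open>x\<close> in the relative interior.\<close>

lemma interval_imp_convex: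
  fixes \<Omega> :: "'a::euclidean_space set"
  assumes "convex \<Omega>" "proper_combinations_in_rel_interior \<Omega>" "closed A"
    "general_position_codim_two \<Omega> A" and f: "interval_convex_fun_on (\<Omega> - A) f"
  shows "convex_fun_on (\<Omega> - A) f"
  unfolding convex_fun_on_def
proof (intro allI impI, elim conjE)
  fix k :: nat and l :: "nat \<Rightarrow> real" and y x
  assume ly: "\<forall>i\<in>{1..k}. 0 \<le> l i \<and> y i \<in> \<Omega> - A" and sum1: "(\<Sum>i=1..k. l i) = 1"
    and x: "x = (\<Sum>i=1..k. l i *\<^sub>R y i)" and xS: "x \<in> \<Omega> - A"
  define I where "I = {i \<in> {1..k}. y i \<noteq> x}"
  define s where "s = sum l I"
  have split: "(\<Sum>i=1..k. g i) = sum g I + sum g ({1..k} - I)" for g :: "nat \<Rightarrow> 'b::comm_monoid_add"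
    by (subst add.commute, intro sum.subset_diff) (auto simp: I_def)
  have rest: "sum l ({1..k} - I) = 1 - s" using split[of l] sum1 by (simp add: s_def)
  have "(\<Sum>i\<in>{1..k} - I. l i *\<^sub>R y i) = (\<Sum>i\<in>{1..k} - I. l i *\<^sub>R x)"
    by (intro sum.cong) (auto simp: I_def)
  then have "x = (\<Sum>i\<in>I. l i *\<^sub>R y i) + (\<Sum>i\<in>{1..k} - I. l i *\<^sub>R x)"
    using x split[of "\<lambda>i. l i *\<^sub>R y i"] by simp
  then have "x = (\<Sum>i\<in>I. l i *\<^sub>R y i) + (1 - s) *\<^sub>R x"
    by (simp only: scaleR_sum_left[symmetric] rest)
  then have xI: "(\<Sum>i\<in>I. l i *\<^sub>R y i) = s *\<^sub>R x"
    by (simp add: algebra_simps)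
  have "(\<Sum>i\<in>{1..k} - I. l i * f (y i)) = (\<Sum>i\<in>{1..k} - I. l i * f x)"
    by (intro sum.cong) (auto simp: I_def)
  then have fI: "(\<Sum>i=1..k. l i * f (y i)) = (\<Sum>i\<in>I. l i * f (y i)) + (1 - s) * f x"
    by (simp only: split[of "\<lambda>i. l i * f (y i)"] sum_distrib_right[symmetric] rest)
  have "0 \<le> s" unfolding s_def using ly by (intro sum_nonneg) (auto simp: I_def)
  have "s * f x \<le> (\<Sum>i\<in>I. l i * f (y i))"
  proof (cases "s = 0")
    case True
    then have "\<forall>i\<in>I. l i = 0"
      using ly unfolding s_def by (subst (asm) sum_nonneg_eq_0_iff) (auto simp: I_def)
    then show ?thesis using True by simp
  next
    case False
    then have s: "s > 0" using \<open>0 \<le> s\<close> by simp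
    obtain j where j: "j \<in> I" using False unfolding s_def by fastforce
    \<comment> \<open>The index range stays \<open>{1..k}\<close>: removed indices get weight 0 and
      the dummy point \<open>y j\<close>, which differs from \<open>x\<close> because
      \<open>j \<in> I\<close>.\<close>
    define l' y' where "l' i = (if i \<in> I then l i / s else 0)"
      and "y' i = (if i \<in> I then y i else y j)" for i
    have restrict: "(\<Sum>i=1..k. g (l' i) (y' i)) = (\<Sum>i\<in>I. g (l i / s) (y i))"
      if "\<And>v. g 0 v = 0" for g :: "real \<Rightarrow> 'a \<Rightarrow> 'b::comm_monoid_add"
      unfolding split by (simp add: l'_def y'_def that)
    have l': "0 \<le> l' i" and y': "y' i \<in> \<Omega> - A" "y' i \<noteq> x" if "i \<in> {1..k}" for i
      using that ly s j by (auto simp: l'_def y'_def I_def)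
    have sum1': "(\<Sum>i=1..k. l' i) = 1"
      using restrict[of "\<lambda>a v. a"] s by (simp add: s_def sum_divide_distrib[symmetric])
    have "(\<Sum>i=1..k. l' i *\<^sub>R y' i) = (\<Sum>i\<in>I. (1 / s) *\<^sub>R (l i *\<^sub>R y i))"
      using restrict[of "\<lambda>a v. a *\<^sub>R v"] by simp
    also have "\<dots> = x" using s by (simp only: scaleR_sum_right[symmetric] xI) simp
    finally have x': "x = (\<Sum>i=1..k. l' i *\<^sub>R y' i)" by simp
    have "x \<in> rel_interior \<Omega>"
      using assms(2) xS l' y' sum1' x' unfolding proper_combinations_in_rel_interior_def
      by (elim allE[of _ k] allE[of _ l'] allE[of _ y'] allE[of _ x]) auto
    then have "f x \<le> (\<Sum>i=1..k. l' i * f (y' i))"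
      using interval_convex_at_rel_interior[OF assms(1,3,4) f l' y'(1) sum1' x'] xS by auto
    also have "\<dots> = (\<Sum>i\<in>I. l i * f (y i)) / s"
      using restrict[of "\<lambda>a v. a * f v"] by (simp add: sum_divide_distrib)
    finally show ?thesis using s by (simp add: field_simps)
  qed
  then show "f x \<le> (\<Sum>i=1..k. l i * f (y i))"
    unfolding fI by (simp add: algebra_simps)
qed

theorem theorem5p2:
  fixes \<Omega> A :: "(real ^ 'n) set" and f :: "real ^ 'n \<Rightarrow> real"
  assumes "convex \<Omega>"
    and "proper_combinations_in_rel_interior \<Omega>"
    and "closed A"
    and "general_position_codim_two \<Omega> A"
  shows "(convex_fun_on (\<Omega> - A) f \<longleftrightarrow> locally_convex_fun_on (\<Omega> - A) f) \<and>
         (convex_fun_on (\<Omega> - A) f \<longleftrightarrow> interval_convex_fun_on (\<Omega> - A) f) \<and>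
         (strict_convex_fun_on (\<Omega> - A) f \<longleftrightarrow> strict_locally_convex_fun_on (\<Omega> - A) f) \<and>
         (strict_convex_fun_on (\<Omega> - A) f \<longleftrightarrow> strict_interval_convex_fun_on (\<Omega> - A) f)"
proof -
  have c_l: "locally_convex_fun_on (\<Omega> - A) f" if "convex_fun_on (\<Omega> - A) f"
    unfolding locally_convex_fun_on_def
    using convex_fun_on_subset[OF that] by (meson inf_le2 zero_less_one)
  have sc_sl: "strict_locally_convex_fun_on (\<Omega> - A) f" if "strict_convex_fun_on (\<Omega> - A) f"
    unfolding strict_locally_convex_fun_on_def
    using strict_convex_fun_on_subset[OF that] by (meson inf_le2 zero_less_one)
  \<comment> \<open>Strict interval convexity yields both ordinary convexity on
    \<open>\<Omega> - A\<close> and strict local convexity, and the contraction argument combines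
    them.\<close>
  have si_sc: "strict_convex_fun_on (\<Omega> - A) f" if "strict_interval_convex_fun_on (\<Omega> - A) f"
    by (rule strict_locally_and_convex_imp_strict_convex[OF assms(1,3)
          interval_imp_convex[OF assms strict_interval_imp_interval[OF that]]
          strict_interval_imp_strict_locally_convex[OF assms(1,3) that]])
  \<comment> \<open>Both equivalences close as cycles: convex, locally convex, interval convex, and
    back to convex, and likewise for the strict notions.\<close>
  show ?thesis
    using c_l sc_sl si_sc interval_imp_convex[OF assms] locally_imp_interval_convex
      strict_locally_imp_strict_interval_convex by blast
qed

end
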